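(* Let $E$ be a monotone $\sigma$-complete atomic pseudo-effect algebra with the Riesz Decomposition Property (RDP), and suppose that the set $A(E)=\{a_i\mid i\in I\}$ of atoms of $E$ is at most countable. Then $E$ is commutative, i.e., $E$ is an effect algebra: for all $a,b\in E$, $a+b$ is defined iff $b+a$ is defined, and then $a+b=b+a$.
   Context: A pseudo-effect algebra is a structure $(E;+,0,1)$, where $+$ is a partial binary operation and $0,1$ are constants, such that for all $a,b,c\in E$: (PE1) $a+b$ and $(a+b)+c$ exist iff $b+c$ and $a+(b+c)$ exist, and in this case $(a+b)+c=a+(b+c)$; (PE2) there are exactly one $d\in E$ and exactly one $e\in E$ such that $a+d=e+a=1$; (PE3) if $a+b$ exists, there are $d,e\in E$ such that $a+b=d+a=b+e$; (PE4) if $a+1$ or $1+a$ exists, then $a=0$. The partial order on $E$ is $a\leqslant b$ iff $a+c=b$ for some $c\in E$ (equivalently, $d+a=b$ for some $d\in E$). RDP: whenever $a_1+a_2=b_1+b_2$ in $E$, there are $c_{11},c_{12},c_{21},c_{22}\in E$ with $a_i=c_{i1}+c_{i2}$ and $b_j=c_{1j}+c_{2j}$ for $i,j\in\{1,2\}$. An atom of $E$ is an element $a\neq 0$ such that $\{x\in E\mid 0\leqslant x\leqslant a\}=\{0,a\}$. $E$ is atomic if for every nonzero $x\in E$ there is an atom $a\leqslant x$. $E$ is monotone $\sigma$-complete if every ascending sequence $x_1\leqslant x_2\leqslant\cdots$ in $E$ has a supremum in $E$. A pseudo-effect algebra is an effect algebra iff $+$ is commutative in the sense stated in the claim. *)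

theory Defs
  imports "HOL-Library.Countable_Set"
begin

text \<open>The underlying set of the algebra is the whole type \<open>'a\<close>; the partial addition returns
  \<open>None\<close> exactly where it is undefined.  In \<open>PE1\<close>, equality of the two monadic binds says that
  one iterated sum exists iff the other one does, and that they then agree.\<close>

locale pseudo_effect_algebra =
  fixes add :: "'a \<Rightarrow> 'a \<Rightarrow> 'a option" (infixl "\<oplus>" 65)
    and zero :: 'a ("\<zero>")
    and one :: 'a ("\<one>")
  assumes PE1: "Option.bind (a \<oplus> b) (\<lambda>s. s \<oplus> c) = Option.bind (b \<oplus> c) (\<lambda>t. a \<oplus> t)"
    and PE2: "(\<exists>!d. a \<oplus> d = Some \<one>) \<and> (\<exists>!e. e \<oplus> a = Some \<one>)"
    and PE3: "a \<oplus> b = Some s \<Longrightarrow> \<exists>d e. d \<oplus> a = Some s \<and> b \<oplus> e = Some s"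
    and PE4: "a \<oplus> \<one> \<noteq> None \<or> \<one> \<oplus> a \<noteq> None \<Longrightarrow> a = \<zero>"
begin

definition le :: "'a \<Rightarrow> 'a \<Rightarrow> bool" (infix "\<preceq>" 50)
  where "a \<preceq> b \<longleftrightarrow> (\<exists>c. a \<oplus> c = Some b)"

lemma le_iff_right: "a \<preceq> b \<longleftrightarrow> (\<exists>d. d \<oplus> a = Some b)"
  unfolding le_def using PE3 by blast

definition RDP :: bool
  where "RDP \<longleftrightarrow> (\<forall>a1 a2 b1 b2. a1 \<oplus> a2 \<noteq> None \<and> a1 \<oplus> a2 = b1 \<oplus> b2 \<longrightarrow>
    (\<exists>c11 c12 c21 c22.
        Some a1 = c11 \<oplus> c12 \<and> Some a2 = c21 \<oplus> c22 \<and>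
        Some b1 = c11 \<oplus> c21 \<and> Some b2 = c12 \<oplus> c22))"

definition is_atom :: "'a \<Rightarrow> bool"
  where "is_atom a \<longleftrightarrow> a \<noteq> \<zero> \<and> {x. \<zero> \<preceq> x \<and> x \<preceq> a} = {\<zero>, a}"

definition atomic :: bool
  where "atomic \<longleftrightarrow> (\<forall>x. x \<noteq> \<zero> \<longrightarrow> (\<exists>a. is_atom a \<and> a \<preceq> x))"

definition is_supremum :: "'a set \<Rightarrow> 'a \<Rightarrow> bool"
  where "is_supremum S s \<longleftrightarrow> (\<forall>x\<in>S. x \<preceq> s) \<and> (\<forall>u. (\<forall>x\<in>S. x \<preceq> u) \<longrightarrow> s \<preceq> u)"

definition monotone_sigma_complete :: bool
  where "monotone_sigma_complete \<longleftrightarrow>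
    (\<forall>x :: nat \<Rightarrow> 'a. (\<forall>n. x n \<preceq> x (Suc n)) \<longrightarrow> (\<exists>s. is_supremum (range x) s))"

end

text \<open>Commutativity of a partial operation: both sides are defined for the same arguments,
  and where they are defined they agree.\<close>

locale effect_algebra = pseudo_effect_algebra +
  assumes add_commute: "(a \<oplus> b \<noteq> None \<longleftrightarrow> b \<oplus> a \<noteq> None) \<and> (a \<oplus> b \<noteq> None \<longrightarrow> a \<oplus> b = b \<oplus> a)"

end

theory Submission
  imports Defs
begin

text \<open>
  For an atom \<open>a\<close> and an element \<open>x\<close>, count how often \<open>a\<close> occurs in \<open>x\<close>: the multiplicity is the
  largest \<open>n\<close> for which the \<open>n\<close>-fold sum of \<open>a\<close> exists and lies below \<open>x\<close>.  The proof rests on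
  three facts about this number.

  It is finite (\<open>sigma_complete_imp_archimedean\<close>): if all multiples of \<open>a\<close> existed, their supremum
  \<open>s\<close> would satisfy \<open>a + s = s\<close>, which is impossible for \<open>a \<noteq> \<zero>\<close>.

  It is additive (\<open>mult_add\<close>): by RDP a multiple of an atom below \<open>x + y\<close> splits into a part below
  \<open>x\<close> and a part below \<open>y\<close>, and both parts are again multiples of that atom.

  It determines the element (\<open>mult_inject\<close>): along an enumeration of the countably many atoms, the
  sums of the first atoms, each taken with its multiplicity in \<open>x\<close>, increase to \<open>x\<close>, since
  anything left over above their supremum would contain one more copy of some atom.

  Commutativity is now immediate.  If \<open>a + b\<close> exists, then \<open>a + b = d + a\<close> for some \<open>d\<close> by \<open>PE3\<close>.
  Since addition of natural numbers commutes, \<open>d\<close> and \<open>b\<close> have the same multiplicities, so \<open>d = b\<close>.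
\<close>

section \<open>Elementary arithmetic of pseudo-effect algebras\<close>

context pseudo_effect_algebra
begin

lemma assoc_right:
  assumes "a \<oplus> b = Some s" "s \<oplus> c = Some u"
  obtains t where "b \<oplus> c = Some t" "a \<oplus> t = Some u"
  using PE1[of a b c] assms that by (cases "b \<oplus> c") auto

lemma assoc_left:
  assumes "b \<oplus> c = Some t" "a \<oplus> t = Some u"
  obtains s where "a \<oplus> b = Some s" "s \<oplus> c = Some u"
  using PE1[of a b c] assms that by (cases "a \<oplus> b") auto

lemma one_add_zero: "\<one> \<oplus> \<zero> = Some \<one>" and zero_add_one: "\<zero> \<oplus> \<one> = Some \<one>"
  using PE2[of \<one>] PE4 by (metis option.distinct(1))+

text \<open>Every element is a complement, and absorbing a zero does not change what it complements; the
  uniqueness of complements does the rest.\<close>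

lemma add_zero [simp]: "a \<oplus> \<zero> = Some a"
proof -
  obtain c where c: "c \<oplus> a = Some \<one>" using PE2 by blast
  then obtain t where "a \<oplus> \<zero> = Some t" "c \<oplus> t = Some \<one>"
    using one_add_zero by (rule assoc_right)
  with c show ?thesis using PE2 by metis
qed

lemma zero_add [simp]: "\<zero> \<oplus> a = Some a"
proof -
  obtain c where c: "a \<oplus> c = Some \<one>" using PE2 by blast
  then obtain t where "\<zero> \<oplus> a = Some t" "t \<oplus> c = Some \<one>"
    using zero_add_one by (rule assoc_left)
  with c show ?thesis using PE2 by metis
qed

text \<open>Completing the common sum \<open>s\<close> to the unit by \<open>e\<close> on the left makes both \<open>b\<close> and \<open>c\<close> right
  complements of \<open>e + a\<close>.\<close>

lemma left_cancel:
  assumes "a \<oplus> b = Some s" "a \<oplus> c = Some s"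
  shows "b = c"
proof -
  obtain e where e: "e \<oplus> s = Some \<one>" using PE2 by blast
  obtain p where "e \<oplus> a = Some p" "p \<oplus> b = Some \<one>" using assms(1) e by (rule assoc_left)
  moreover obtain q where "e \<oplus> a = Some q" "q \<oplus> c = Some \<one>" using assms(2) e by (rule assoc_left)
  ultimately show ?thesis using PE2 by (metis option.inject)
qed

lemma add_eq_zero:
  assumes "a \<oplus> b = Some \<zero>"
  shows "a = \<zero>"
  using assoc_left[OF assms one_add_zero] PE4 by (metis option.distinct(1))

lemma le_refl: "a \<preceq> a"
  unfolding le_def using add_zero by blast

lemma zero_le: "\<zero> \<preceq> a"
  unfolding le_def using zero_add by blast

lemma le_trans: "a \<preceq> b \<Longrightarrow> b \<preceq> c \<Longrightarrow> a \<preceq> c"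
  unfolding le_def by (metis assoc_right)

lemma le_antisym:
  assumes "a \<preceq> b" "b \<preceq> a"
  shows "a = b"
proof -
  obtain c d where c: "a \<oplus> c = Some b" and d: "b \<oplus> d = Some a"
    using assms unfolding le_def by blast
  obtain t where "c \<oplus> d = Some t" "a \<oplus> t = Some a" using c d by (rule assoc_right)
  then have "c = \<zero>" using left_cancel[of a t a \<zero>] add_eq_zero by auto
  with c show ?thesis by simp
qed

lemma le_zero: "a \<preceq> \<zero> \<Longrightarrow> a = \<zero>"
  using le_antisym zero_le by blast

lemma summands_le:
  assumes "a \<oplus> b = Some s"
  shows "a \<preceq> s" "b \<preceq> s"
  using assms le_def le_iff_right by blast+

lemma add_le_cancel_left:
  assumes "a \<oplus> x = Some s" "a \<oplus> y = Some t" "s \<preceq> t"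
  shows "x \<preceq> y"
proof -
  obtain c where "s \<oplus> c = Some t" using assms(3) le_def by blast
  with assms(1) obtain v where "x \<oplus> c = Some v" "a \<oplus> v = Some t" by (rule assoc_right)
  then show ?thesis using assms(2) left_cancel le_def by blast
qed

lemma summands_mono:
  assumes xy: "x \<oplus> y = Some z" and "s \<preceq> x" "t \<preceq> y"
  obtains u where "s \<oplus> t = Some u" "u \<preceq> z"
proof -
  \<comment> \<open>The remainders are split off on the outer sides, so that \<open>s\<close> and \<open>t\<close> become adjacent.\<close>
  obtain p where p: "p \<oplus> s = Some x" using assms(2) le_iff_right by blast
  obtain q where q: "t \<oplus> q = Some y" using assms(3) le_def by blast
  obtain v where v: "s \<oplus> y = Some v" "p \<oplus> v = Some z" using p xy by (rule assoc_right)
  obtain u where u: "s \<oplus> t = Some u" "u \<oplus> q = Some v" using q v(1) by (rule assoc_left)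
  show ?thesis
    using that u summands_le v(2) le_trans by blast
qed

lemma atom_nonzero: "is_atom a \<Longrightarrow> a \<noteq> \<zero>"
  by (simp add: is_atom_def)

lemma le_atom: "is_atom a \<Longrightarrow> x \<preceq> a \<Longrightarrow> x = \<zero> \<or> x = a"
  unfolding is_atom_def using zero_le by blast

lemma atom_add:
  assumes "is_atom a" "x \<oplus> y = Some a"
  shows "x = \<zero> \<and> y = a \<or> x = a \<and> y = \<zero>"
  using le_atom[OF assms(1) summands_le(1)[OF assms(2)]] assms(2)
    left_cancel[of a y a \<zero>] by auto

section \<open>Multiples\<close>

primrec multiple :: "nat \<Rightarrow> 'a \<Rightarrow> 'a option" where
  "multiple 0 a = Some \<zero>"
| "multiple (Suc n) a = Option.bind (multiple n a) (\<lambda>s. a \<oplus> s)"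

lemma multiple_add:
  assumes "multiple i a = Some s" "multiple j a = Some t" "s \<oplus> t = Some u"
  shows "multiple (i + j) a = Some u"
  using assms(1,3)
proof (induction i arbitrary: s u)
  case 0
  then have "\<zero> \<oplus> t = Some u" by simp
  then show ?case using assms(2) by simp
next
  case (Suc i)
  obtain r where r: "multiple i a = Some r" "a \<oplus> r = Some s"
    using Suc.prems(1) by (auto simp: bind_eq_Some_conv)
  obtain v where "r \<oplus> t = Some v" "a \<oplus> v = Some u"
    using r(2) Suc.prems(2) by (rule assoc_right)
  then show ?case using Suc.IH[OF r(1)] by simp
qed

text \<open>Existence of the multiple is part of the condition, so the \<open>n\<close> that satisfy it form an initial
  segment of the natural numbers, whichever multiples of \<open>a\<close> exist.\<close>

definition multiple_le :: "nat \<Rightarrow> 'a \<Rightarrow> 'a \<Rightarrow> bool" where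
  "multiple_le n a x \<longleftrightarrow> (\<exists>s. multiple n a = Some s \<and> s \<preceq> x)"

lemma multiple_le_0: "multiple_le 0 a x"
  by (simp add: multiple_le_def zero_le)

lemma multiple_le_Suc:
  assumes "multiple_le (Suc n) a x"
  shows "multiple_le n a x"
  using assms summands_le(2) le_trans
  by (fastforce simp: multiple_le_def bind_eq_Some_conv)

lemma multiple_le_antimono: "multiple_le n a x \<Longrightarrow> m \<le> n \<Longrightarrow> multiple_le m a x"
  by (induction n) (auto simp: le_Suc_eq dest: multiple_le_Suc)

text \<open>Decomposing \<open>a + n a = x + y\<close> with RDP puts the leading atom \<open>a\<close> entirely into \<open>x\<close> or entirely
  into \<open>y\<close>, always at the front, so that the induction goes through without commutativity.\<close>

lemma multiple_atom_split:
  assumes RDP and a: "is_atom a" and "multiple n a = Some s" "x \<oplus> y = Some s"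
  shows "\<exists>i j. n = i + j \<and> multiple i a = Some x \<and> multiple j a = Some y"
  using assms(3,4)
proof (induction n arbitrary: s x y)
  case 0
  then have xy: "x \<oplus> y = Some \<zero>" by simp
  then have "x = \<zero>" by (rule add_eq_zero)
  with xy have "y = \<zero>" by simp
  with \<open>x = \<zero>\<close> show ?case by simp
next
  case (Suc n)
  obtain r where r: "multiple n a = Some r" "a \<oplus> r = Some s"
    using Suc.prems(1) by (auto simp: bind_eq_Some_conv)
  obtain p q x' y' where c: "p \<oplus> q = Some a" "x' \<oplus> y' = Some r"
    "p \<oplus> x' = Some x" "q \<oplus> y' = Some y"
    using \<open>RDP\<close> r(2) Suc.prems(2) unfolding RDP_def by (metis option.distinct(1))
  obtain i j where ij: "n = i + j" "multiple i a = Some x'" "multiple j a = Some y'"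
    using Suc.IH[OF r(1) c(2)] by blast
  from atom_add[OF a c(1)] show ?case
  proof
    assume "p = \<zero> \<and> q = a"
    then have "multiple i a = Some x" "multiple (Suc j) a = Some y" using c(3,4) ij by auto
    then show ?thesis using ij(1) by (metis add_Suc_right)
  next
    assume "p = a \<and> q = \<zero>"
    then have "multiple (Suc i) a = Some x" "multiple j a = Some y" using c(3,4) ij by auto
    then show ?thesis using ij(1) by (metis add_Suc)
  qed
qed

lemma multiple_le_add_iff:
  assumes RDP and "is_atom a" and z: "x \<oplus> y = Some z"
  shows "multiple_le n a z \<longleftrightarrow> (\<exists>i j. n = i + j \<and> multiple_le i a x \<and> multiple_le j a y)"
proof
  assume "multiple_le n a z"
  then obtain s r where s: "multiple n a = Some s" "s \<oplus> r = Some z"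
    unfolding multiple_le_def le_def by blast
  obtain p q p' q' where c: "p \<oplus> q = Some s" "p \<oplus> p' = Some x" "q \<oplus> q' = Some y"
    using \<open>RDP\<close> s(2) z unfolding RDP_def by (metis option.distinct(1))
  show "\<exists>i j. n = i + j \<and> multiple_le i a x \<and> multiple_le j a y"
    using multiple_atom_split[OF assms(1,2) s(1) c(1)] c(2,3)
    unfolding multiple_le_def le_def by blast
next
  assume "\<exists>i j. n = i + j \<and> multiple_le i a x \<and> multiple_le j a y"
  then obtain i j s t where n: "n = i + j"
    and s: "multiple i a = Some s" "s \<preceq> x" and t: "multiple j a = Some t" "t \<preceq> y"
    unfolding multiple_le_def by blast
  obtain u where u: "s \<oplus> t = Some u" "u \<preceq> z" using z s(2) t(2) by (rule summands_mono)
  show "multiple_le n a z"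
    unfolding multiple_le_def n using multiple_add[OF s(1) t(1) u(1)] u(2) by blast
qed

definition archimedean :: bool where
  "archimedean \<longleftrightarrow> (\<forall>a. a \<noteq> \<zero> \<longrightarrow> (\<exists>n. multiple n a = None))"

text \<open>If all multiples of \<open>a\<close> exist, their supremum \<open>s\<close> has the form \<open>a + t\<close>.  Cancelling \<open>a\<close> in
  \<open>(n + 1) a \<preceq> a + t\<close> shows that \<open>t\<close> is an upper bound as well, so \<open>t = s\<close> and \<open>a = \<zero>\<close>.\<close>

lemma sigma_complete_imp_archimedean:
  assumes monotone_sigma_complete
  shows archimedean
  unfolding archimedean_def
proof (intro allI impI, rule ccontr)
  fix a assume "a \<noteq> \<zero>" and "\<nexists>n. multiple n a = None"
  then have "\<forall>n. \<exists>s. multiple n a = Some s" by auto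
  then obtain x where x: "\<And>n. multiple n a = Some (x n)" by metis
  have step: "a \<oplus> x n = Some (x (Suc n))" for n
    using x[of "Suc n"] x[of n] by simp
  then have "x n \<preceq> x (Suc n)" for n
    using summands_le(2) by blast
  then obtain s where s: "is_supremum (range x) s"
    using assms unfolding monotone_sigma_complete_def by blast
  have "x 0 = \<zero>" using x[of 0] by simp
  then have "x (Suc 0) = a" using step[of 0] by simp
  then have "a \<preceq> s" using s unfolding is_supremum_def by (metis rangeI)
  then obtain t where t: "a \<oplus> t = Some s" using le_def by blast
  have "x n \<preceq> t" for n
    using add_le_cancel_left[OF step t] s unfolding is_supremum_def by blast
  then have "s \<preceq> t" using s unfolding is_supremum_def by blast
  then have "t = s" using summands_le(2)[OF t] le_antisym by blast
  then have "a \<oplus> s = Some s" using t by simp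
  \<comment> \<open>Adding the complement of \<open>s\<close> on the right turns this into \<open>a + 1 = 1\<close>, where \<open>PE4\<close> applies.\<close>
  moreover obtain c where "s \<oplus> c = Some \<one>" using PE2 by blast
  ultimately obtain v where "s \<oplus> c = Some v" "a \<oplus> v = Some \<one>" by (rule assoc_right)
  then have "a = \<zero>" using \<open>s \<oplus> c = Some \<one>\<close> PE4[of a] by auto
  with \<open>a \<noteq> \<zero>\<close> show False ..
qed

end

section \<open>Multiplicities of atoms\<close>

locale archimedean_RDP_algebra = pseudo_effect_algebra +
  assumes arch: archimedean and RDP: RDP
begin

definition mult :: "'a \<Rightarrow> 'a \<Rightarrow> nat" where
  "mult a x = (GREATEST n. multiple_le n a x)"

text \<open>The archimedean property bounds the set in the definition of \<open>mult\<close>, so that its greatest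
  element exists; additivity and the values on atoms are read off from this characterization.\<close>

lemma multiple_le_iff:
  assumes "a \<noteq> \<zero>"
  shows "multiple_le n a x \<longleftrightarrow> n \<le> mult a x"
proof -
  obtain k where "multiple k a = None" using arch assms unfolding archimedean_def by blast
  then have "\<not> multiple_le k a x" by (simp add: multiple_le_def)
  then have bound: "m \<le> k" if "multiple_le m a x" for m
    using multiple_le_antimono that nat_le_linear by blast
  have "multiple_le (mult a x) a x"
    unfolding mult_def using multiple_le_0 bound by (rule GreatestI_nat)
  moreover have "n \<le> mult a x" if "multiple_le n a x"
    unfolding mult_def using that bound by (rule Greatest_le_nat)
  ultimately show ?thesis using multiple_le_antimono by blast
qed

lemma mult_add:
  assumes "is_atom a" "x \<oplus> y = Some z"
  shows "mult a z = mult a x + mult a y"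
proof -
  have "n \<le> mult a z \<longleftrightarrow> (\<exists>i j. n = i + j \<and> i \<le> mult a x \<and> j \<le> mult a y)" for n
    using multiple_le_add_iff[OF RDP assms] multiple_le_iff[OF atom_nonzero[OF assms(1)]] by simp
  from this[of "mult a z"] this[of "mult a x + mult a y"] show ?thesis
    by (auto intro: order_antisym)
qed

lemma mult_zero:
  assumes "is_atom a"
  shows "mult a \<zero> = 0"
  using mult_add[OF assms zero_add[of \<zero>]] by simp

lemma mult_pos:
  assumes "is_atom a" "a \<preceq> x"
  shows "mult a x > 0"
  using multiple_le_iff[OF atom_nonzero[OF assms(1)], of 1 x] assms(2)
  by (simp add: multiple_le_def)

lemma mult_atom:
  assumes "is_atom a" "is_atom b"
  shows "mult a b = (if a = b then 1 else 0)"
proof (cases "a = b")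
  case True
  have "\<not> multiple_le 2 a a"
  proof
    assume "multiple_le 2 a a"
    then obtain s where s: "a \<oplus> a = Some s" "s \<preceq> a"
      by (auto simp: multiple_le_def numeral_2_eq_2)
    then have "a \<preceq> \<zero>" using add_le_cancel_left[OF s(1) add_zero] by simp
    then show False using le_zero atom_nonzero[OF assms(1)] by blast
  qed
  then show ?thesis
    using True mult_pos[OF assms(1) le_refl] multiple_le_iff[OF atom_nonzero[OF assms(1)], of 2 a]
    by simp
next
  case False
  have "\<not> multiple_le 1 a b"
    using le_atom[OF assms(2), of a] atom_nonzero[OF assms(1)] False
    by (auto simp: multiple_le_def)
  then show ?thesis
    using False multiple_le_iff[OF atom_nonzero[OF assms(1)], of 1 b] by simp
qed

lemma mult_multiple:
  assumes "is_atom a" "is_atom b" "multiple n b = Some s"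
  shows "mult a s = (if a = b then n else 0)"
  using assms(3)
proof (induction n arbitrary: s)
  case 0
  then show ?case using mult_zero[OF assms(1)] by simp
next
  case (Suc n)
  then obtain r where "multiple n b = Some r" "b \<oplus> r = Some s"
    by (auto simp: bind_eq_Some_conv)
  then show ?case
    using Suc.IH mult_add[OF assms(1)] mult_atom[OF assms(1,2)] by simp
qed

lemma multiple_le_mult:
  assumes "is_atom a"
  obtains s where "multiple (mult a x) a = Some s" "s \<preceq> x"
  using multiple_le_iff[OF atom_nonzero[OF assms], of "mult a x" x] multiple_le_def by auto

section \<open>Elements as sums of their atoms\<close>

text \<open>The sum of the multiples \<open>m a\<close> of \<open>a\<close> over the distinct atoms \<open>a\<close> among \<open>e 0, \<dots>, e (n - 1)\<close>.  The
  enumeration may repeat values, as it must if there are only finitely many atoms.  It depends on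
  an element only through a multiplicity function, which is what makes \<open>mult_inject\<close> work.\<close>

primrec atom_sum :: "(nat \<Rightarrow> 'a) \<Rightarrow> ('a \<Rightarrow> nat) \<Rightarrow> nat \<Rightarrow> 'a" where
  "atom_sum e m 0 = \<zero>"
| "atom_sum e m (Suc n) = (if e n \<in> e ` {..<n} then atom_sum e m n
     else the (atom_sum e m n \<oplus> the (multiple (m (e n)) (e n))))"

text \<open>A new atom \<open>e n\<close> does not occur in the sum formed so far, hence by additivity it occurs in the
  remainder with its full multiplicity, which leaves room to add that multiple to the sum.\<close>

lemma atom_sum_Suc:
  assumes "is_atom (e n)" "e n \<notin> e ` {..<n}"
    and "atom_sum e (\<lambda>a. mult a x) n \<preceq> x" "mult (e n) (atom_sum e (\<lambda>a. mult a x) n) = 0"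
  obtains s where "multiple (mult (e n) x) (e n) = Some s"
    "atom_sum e (\<lambda>a. mult a x) n \<oplus> s = Some (atom_sum e (\<lambda>a. mult a x) (Suc n))"
    "atom_sum e (\<lambda>a. mult a x) (Suc n) \<preceq> x"
proof -
  let ?S = "atom_sum e (\<lambda>a. mult a x)"
  obtain t where t: "?S n \<oplus> t = Some x" using assms(3) le_def by blast
  have "mult (e n) t = mult (e n) x" using mult_add[OF assms(1) t] assms(4) by simp
  then obtain s where s: "multiple (mult (e n) x) (e n) = Some s" "s \<preceq> t"
    using multiple_le_mult[OF assms(1), of t] by auto
  obtain u where u: "?S n \<oplus> s = Some u" "u \<preceq> x"
    using t le_refl s(2) by (rule summands_mono)
  have "?S (Suc n) = u" using assms(2) s(1) u(1) by simp
  with that s(1) u show thesis by blast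
qed

lemma atom_sum_le_and_mult:
  assumes "\<And>n. is_atom (e n)"
  shows "atom_sum e (\<lambda>a. mult a x) n \<preceq> x \<and>
    (\<forall>a. is_atom a \<longrightarrow> mult a (atom_sum e (\<lambda>a. mult a x) n) =
      (if a \<in> e ` {..<n} then mult a x else 0))"
proof (induction n)
  case 0
  show ?case using zero_le mult_zero by simp
next
  case (Suc n)
  let ?S = "atom_sum e (\<lambda>a. mult a x)"
  show ?case
  proof (cases "e n \<in> e ` {..<n}")
    case True
    then have "e ` {..<Suc n} = e ` {..<n}" by (auto simp: lessThan_Suc)
    then show ?thesis using Suc True by simp
  next
    case False
    obtain s where s: "multiple (mult (e n) x) (e n) = Some s"
      "?S n \<oplus> s = Some (?S (Suc n))" "?S (Suc n) \<preceq> x"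
      using False Suc assms by (metis atom_sum_Suc)
    have "mult a (?S (Suc n)) = (if a \<in> e ` {..<Suc n} then mult a x else 0)"
      if "is_atom a" for a
      using mult_add[OF that s(2)] mult_multiple[OF that assms s(1)] Suc that False
      by (auto simp: lessThan_Suc simp del: atom_sum.simps)
    then show ?thesis using s(3) by blast
  qed
qed

lemma atom_sum_mono:
  assumes "\<And>n. is_atom (e n)"
  shows "atom_sum e (\<lambda>a. mult a x) n \<preceq> atom_sum e (\<lambda>a. mult a x) (Suc n)"
proof (cases "e n \<in> e ` {..<n}")
  case True
  then show ?thesis using le_refl by simp
next
  case False
  let ?S = "atom_sum e (\<lambda>a. mult a x)"
  have "?S n \<preceq> x" "mult (e n) (?S n) = 0"
    using atom_sum_le_and_mult[of e x n] assms False by auto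
  with assms False show ?thesis by (rule atom_sum_Suc) (rule summands_le(1))
qed

text \<open>The supremum \<open>s\<close> of the partial sums has every atom with at least its multiplicity in \<open>x\<close>.  So
  the remainder \<open>t\<close> in \<open>s + t = x\<close> contains no atom, and atomicity forces \<open>t = \<zero>\<close>.\<close>

lemma is_supremum_atom_sum:
  assumes monotone_sigma_complete atomic and range: "range e = {a. is_atom a}"
  shows "is_supremum (range (atom_sum e (\<lambda>a. mult a x))) x"
proof -
  let ?S = "atom_sum e (\<lambda>a. mult a x)"
  have e: "is_atom (e n)" for n using range by auto
  have "?S n \<preceq> ?S (Suc n)" for n using e by (rule atom_sum_mono)
  then obtain s where s: "is_supremum (range ?S) s"
    using assms(1) unfolding monotone_sigma_complete_def by blast
  have "?S n \<preceq> x" for n using atom_sum_le_and_mult[of e x n] e by blast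
  then have "s \<preceq> x" using s unfolding is_supremum_def by blast
  then obtain t where t: "s \<oplus> t = Some x" using le_def by blast
  have "t = \<zero>"
  proof (rule ccontr)
    assume "t \<noteq> \<zero>"
    then obtain a where a: "is_atom a" "a \<preceq> t" using assms(2) unfolding atomic_def by blast
    then obtain n where n: "a = e n" using range by auto
    have "mult a (?S (Suc n)) = mult a x"
      using atom_sum_le_and_mult[of e x "Suc n"] e a(1) n by (auto simp del: atom_sum.simps)
    moreover have "?S (Suc n) \<preceq> s" using s unfolding is_supremum_def by blast
    then obtain r where "?S (Suc n) \<oplus> r = Some s" using le_def by blast
    ultimately have "mult a x \<le> mult a s" using mult_add[OF a(1)] by (metis le_add1)
    then show False using mult_add[OF a(1) t] mult_pos[OF a] by simp
  qed
  then show ?thesis using s t by simp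
qed

lemma mult_inject:
  assumes monotone_sigma_complete atomic "countable {a. is_atom a}"
    and eq: "\<And>a. is_atom a \<Longrightarrow> mult a x = mult a y"
  shows "x = y"
proof (cases "{a. is_atom a} = {}")
  case True
  then have "z = \<zero>" for z using assms(2) unfolding atomic_def by auto
  from this[of x] this[of y] show ?thesis by simp
next
  case False
  obtain e :: "nat \<Rightarrow> 'a" where e: "range e = {a. is_atom a}"
    using range_from_nat_into[OF False assms(3)] by blast
  have "mult (e n) x = mult (e n) y" for n using eq e by auto
  then have "atom_sum e (\<lambda>a. mult a x) n = atom_sum e (\<lambda>a. mult a y) n" for n
    by (induction n) auto
  then have "atom_sum e (\<lambda>a. mult a x) = atom_sum e (\<lambda>a. mult a y)" by blast
  then show ?thesis
    using is_supremum_atom_sum[OF assms(1,2) e, of x] is_supremum_atom_sum[OF assms(1,2) e, of y]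
    unfolding is_supremum_def by (auto intro!: le_antisym)
qed

lemma add_commute_if_exists:
  assumes monotone_sigma_complete atomic "countable {a. is_atom a}" and s: "x \<oplus> y = Some s"
  shows "y \<oplus> x = Some s"
proof -
  obtain d where d: "d \<oplus> x = Some s" using PE3[OF s] by blast
  have "mult a d = mult a y" if "is_atom a" for a
    using mult_add[OF that s] mult_add[OF that d] by simp
  then have "d = y" by (rule mult_inject[OF assms(1-3)])
  with d show ?thesis by simp
qed

end

theorem theorem5p2:
  fixes add :: "'a \<Rightarrow> 'a \<Rightarrow> 'a option" and zero one :: 'a
  assumes "pseudo_effect_algebra add zero one"
    and "pseudo_effect_algebra.monotone_sigma_complete add"
    and "pseudo_effect_algebra.atomic add zero"
    and "pseudo_effect_algebra.RDP add"
    and "countable {a. pseudo_effect_algebra.is_atom add zero a}"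
  shows "effect_algebra add zero one \<and>
    (\<forall>a b. (add a b \<noteq> None \<longleftrightarrow> add b a \<noteq> None) \<and> (add a b \<noteq> None \<longrightarrow> add a b = add b a))"
proof -
  interpret pseudo_effect_algebra add zero one by (rule assms(1))
  interpret archimedean_RDP_algebra add zero one
    using sigma_complete_imp_archimedean assms(2,4) by unfold_locales
  have "add b a = Some s" if "add a b = Some s" for a b s
    using assms(2,3,5) that by (rule add_commute_if_exists)
  then have comm: "(add a b \<noteq> None \<longleftrightarrow> add b a \<noteq> None) \<and> (add a b \<noteq> None \<longrightarrow> add a b = add b a)" for a b
    by (metis not_None_eq)
  then have "effect_algebra add zero one" by unfold_locales
  with comm show ?thesis by blast
qed

end
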